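(* Let $0<b<1$ and let $\alpha_n=-(n+2)^{-b}$ for $n\ge0$. For $n\ge 1$ let $\zeta^{(n)}_1,\dots,\zeta^{(n)}_n$ be the zeros of $\Phi_n^{(-1)}$, ordered counterclockwise starting from $1$. Then the size of the gap in the zeros of $\Phi_n^{(-1)}$ around $z=1$ is $4\arcsin|\alpha_n|$ to leading order, i.e. \[ \lim_{n\to\infty}\frac{\arg(\zeta_1^{(n)})+2\pi-\arg(\zeta_n^{(n)})}{4\arcsin|\alpha_n|}=1, \] and the neighboring zero spacings are of smaller order, i.e. for every fixed integer $k\ge1$, \[ \lim_{n\to\infty}\frac{\arg(\zeta_{k+1}^{(n)})-\arg(\zeta_k^{(n)})}{|\alpha_n|}=0 \qquad\text{and}\qquad \lim_{n\to\infty}\frac{\arg(\zeta_{n-k+1}^{(n)})-\arg(\zeta_{n-k}^{(n)})}{|\alpha_n|}=0 . \]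
   Context: Given Verblunsky coefficients $\{\alpha_n\}_{n\ge0}$ in the open unit disk $\mathbb{D}$, the monic orthogonal polynomials on the unit circle are defined by $\Phi_0=1$ and the Szegő recursion $\Phi_{n+1}(z)=z\Phi_n(z)-\overline{\alpha}_n\Phi_n^*(z)$, where $\Phi_n^*(z)=z^n\overline{\Phi_n(1/\bar z)}$. For $\beta\in\partial\mathbb{D}$ and $n\ge1$, the paraorthogonal polynomial is $\Phi_n^{(\beta)}(z)=z\Phi_{n-1}(z)-\overline{\beta}\,\Phi_{n-1}^*(z)$; it is known that its $n$ zeros are simple and lie on $\partial\mathbb{D}$. They are ordered counterclockwise starting from $1$: with $\arg$ taking values in $[0,2\pi)$, $0\le\arg\zeta_1^{(n)}<\dots<\arg\zeta_n^{(n)}<2\pi$. *)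

theory Defs
  imports "HOL-Analysis.Analysis" "HOL-Computational_Algebra.Fundamental_Theorem_Algebra"
begin

(* The degree-n reversal p^*: the coefficients are conjugated and reversed relative to n (not
   relative to degree p, as reflect_poly would do).  poly_szego_star below recovers the formula
   p^*(z) = z^n * cnj (p (1 / cnj z)); it is not used as the definition because division by 0
   would give the wrong value at z = 0. *)
definition szego_star :: "nat \<Rightarrow> complex poly \<Rightarrow> complex poly" where
  "szego_star n p = (\<Sum>k\<le>n. monom (cnj (coeff p (n - k))) k)"

(* pCons 0 p is the polynomial z * p(z). *)
primrec opuc :: "(nat \<Rightarrow> complex) \<Rightarrow> nat \<Rightarrow> complex poly" where
  "opuc \<alpha> 0 = 1"
| "opuc \<alpha> (Suc n) = pCons 0 (opuc \<alpha> n) - smult (cnj (\<alpha> n)) (szego_star n (opuc \<alpha> n))"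

(* Meaningful for n >= 1 only. *)
definition popuc :: "(nat \<Rightarrow> complex) \<Rightarrow> complex \<Rightarrow> nat \<Rightarrow> complex poly" where
  "popuc \<alpha> \<beta> n =
     pCons 0 (opuc \<alpha> (n - 1)) - smult (cnj \<beta>) (szego_star (n - 1) (opuc \<alpha> (n - 1)))"

(* z 1, ..., z n are the zeros of p, n in number, in counterclockwise order starting from the
   point 1; Arg2pi takes values in [0, 2 pi).  The lemma ex_ordered_zeros_popuc shows that such
   an enumeration exists for p = popuc \<alpha> \<beta> n. *)
definition ordered_zeros :: "complex poly \<Rightarrow> nat \<Rightarrow> (nat \<Rightarrow> complex) \<Rightarrow> bool" where
  "ordered_zeros p n z \<longleftrightarrow>
     bij_betw z {1..n} {w. poly p w = 0} \<and> strict_mono_on {1..n} (\<lambda>k. Arg2pi (z k))"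

lemma coeff_szego_star: "coeff (szego_star n p) k = (if k \<le> n then cnj (coeff p (n - k)) else 0)"
  by (simp add: szego_star_def coeff_sum)

lemma degree_szego_star: "degree (szego_star n p) \<le> n"
  by (rule degree_le) (simp add: coeff_szego_star)

lemma poly_as_sum_le:
  fixes p :: "complex poly"
  assumes "degree p \<le> n"
  shows "poly p x = (\<Sum>i\<le>n. coeff p i * x ^ i)"
  unfolding poly_altdef
  by (rule sum.mono_neutral_left) (use assms in \<open>auto simp: coeff_eq_0\<close>)

lemma poly_szego_star:
  assumes "degree p \<le> n" "z \<noteq> 0"
  shows "poly (szego_star n p) z = z ^ n * cnj (poly p (1 / cnj z))"
proof -
  have "z ^ n * cnj (poly p (1 / cnj z)) = (\<Sum>i\<le>n. cnj (coeff p i) * z ^ (n - i))"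
    unfolding poly_as_sum_le [OF assms(1)] cnj_sum sum_distrib_left
    using assms(2) by (intro sum.cong) (auto simp: power_diff field_simps)
  also have "\<dots> = (\<Sum>k\<le>n. cnj (coeff p (n - k)) * z ^ k)"
    by (rule sum.reindex_bij_witness[of _ "\<lambda>k. n - k" "\<lambda>k. n - k"]) auto
  finally show ?thesis
    by (simp add: szego_star_def poly_sum poly_monom)
qed

lemma degree_opuc: "degree (opuc \<alpha> n) \<le> n"
proof (induction n)
  case (Suc n)
  have "degree (pCons 0 (opuc \<alpha> n)) \<le> Suc n"
    using Suc degree_pCons_le[of 0 "opuc \<alpha> n"] by linarith
  moreover have "degree (smult (cnj (\<alpha> n)) (szego_star n (opuc \<alpha> n))) \<le> Suc n"
    using degree_szego_star[of n "opuc \<alpha> n"]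
      degree_smult_le[of "cnj (\<alpha> n)" "szego_star n (opuc \<alpha> n)"] by linarith
  ultimately show ?case
    by (simp add: degree_diff_le)
qed auto

lemma coeff_opuc_lead: "coeff (opuc \<alpha> n) n = 1"
  by (induction n) (auto simp: coeff_szego_star)

lemma szego_star_opuc_Suc:
  "szego_star (Suc n) (opuc \<alpha> (Suc n)) =
     szego_star n (opuc \<alpha> n) - smult (\<alpha> n) (pCons 0 (opuc \<alpha> n))"
proof (rule poly_eqI)
  fix k
  have above: "coeff (opuc \<alpha> n) k = 0" if "k > n" for k
    using degree_opuc[of \<alpha> n] that by (intro coeff_eq_0) auto
  show "coeff (szego_star (Suc n) (opuc \<alpha> (Suc n))) k =
          coeff (szego_star n (opuc \<alpha> n) - smult (\<alpha> n) (pCons 0 (opuc \<alpha> n))) k"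
  proof (cases k)
    case (Suc j)
    show ?thesis
    proof (cases "j < n")
      case True
      then obtain i where "n = Suc (i + j)"
        using less_imp_Suc_add by (metis add.commute)
      thus ?thesis using Suc by (simp add: coeff_szego_star)
    qed (use Suc above in \<open>auto simp: coeff_szego_star coeff_opuc_lead\<close>)
  qed (auto simp: coeff_szego_star coeff_opuc_lead above)
qed

lemma szego_step_identity:
  fixes u v a :: complex
  shows "(cmod (v - a * u))\<^sup>2 - (cmod (u - cnj a * v))\<^sup>2 =
           (1 - (cmod a)\<^sup>2) * ((cmod v)\<^sup>2 - (cmod u)\<^sup>2)"
  unfolding cmod_power2 by (simp add: algebra_simps power2_eq_square)

context
  fixes \<alpha> :: "nat \<Rightarrow> complex"
  assumes \<alpha>: "\<And>n. cmod (\<alpha> n) < 1"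
begin

lemma one_minus_alpha: "1 - (cmod (\<alpha> n))\<^sup>2 > 0"
  using \<alpha>[of n] abs_square_less_1[of "cmod (\<alpha> n)"] by simp

lemma opuc_inside:
  assumes "cmod z < 1"
  shows "cmod (z * poly (opuc \<alpha> n) z) < cmod (poly (szego_star n (opuc \<alpha> n)) z)"
proof (induction n)
  case 0
  show ?case using assms by (simp add: szego_star_def)
next
  case (Suc n)
  define u where "u = z * poly (opuc \<alpha> n) z"
  define v where "v = poly (szego_star n (opuc \<alpha> n)) z"
  have "(cmod u)\<^sup>2 < (cmod v)\<^sup>2"
    using Suc unfolding u_def v_def by (intro power_strict_mono) auto
  hence "(cmod (v - \<alpha> n * u))\<^sup>2 - (cmod (u - cnj (\<alpha> n) * v))\<^sup>2 > 0"
    unfolding szego_step_identity using one_minus_alpha[of n] by (intro mult_pos_pos) auto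
  hence "cmod (u - cnj (\<alpha> n) * v) < cmod (v - \<alpha> n * u)"
    by (simp add: power2_less_imp_less)
  moreover have "cmod (z * (u - cnj (\<alpha> n) * v)) \<le> cmod (u - cnj (\<alpha> n) * v)"
    using mult_right_mono[of "cmod z" 1 "cmod (u - cnj (\<alpha> n) * v)"] assms
    by (simp only: norm_mult) simp
  ultimately show ?case
    unfolding szego_star_opuc_Suc by (simp add: u_def v_def mult.left_commute)
qed

lemma opuc_outside:
  assumes "cmod z > 1"
  shows "cmod (z * poly (opuc \<alpha> n) z) > cmod (poly (szego_star n (opuc \<alpha> n)) z)"
proof (induction n)
  case 0
  show ?case using assms by (simp add: szego_star_def)
next
  case (Suc n)
  define u where "u = z * poly (opuc \<alpha> n) z"
  define v where "v = poly (szego_star n (opuc \<alpha> n)) z"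
  have "(cmod v)\<^sup>2 < (cmod u)\<^sup>2"
    using Suc unfolding u_def v_def by (intro power_strict_mono) auto
  hence "(cmod (v - \<alpha> n * u))\<^sup>2 - (cmod (u - cnj (\<alpha> n) * v))\<^sup>2 < 0"
    unfolding szego_step_identity using one_minus_alpha[of n] by (intro mult_pos_neg) auto
  hence "cmod (u - cnj (\<alpha> n) * v) > cmod (v - \<alpha> n * u)"
    by (simp add: power2_less_imp_less)
  moreover have "cmod (z * (u - cnj (\<alpha> n) * v)) \<ge> cmod (u - cnj (\<alpha> n) * v)"
    using mult_right_mono[of 1 "cmod z" "cmod (u - cnj (\<alpha> n) * v)"] assms
    by (simp only: norm_mult) simp
  ultimately show ?case
    unfolding szego_star_opuc_Suc by (simp add: u_def v_def mult.left_commute)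
qed

lemma szego_star_circle:
  assumes "cmod z = 1"
  shows "poly (szego_star n (opuc \<alpha> n)) z = z ^ n * cnj (poly (opuc \<alpha> n) z)"
proof -
  have "z \<noteq> 0" using assms by auto
  moreover have "1 / cnj z = z"
    using assms \<open>z \<noteq> 0\<close> complex_norm_square[of z] by (simp add: field_simps)
  ultimately show ?thesis
    using poly_szego_star[OF degree_opuc] by simp
qed

lemma opuc_circle_nonzero:
  assumes "cmod z = 1"
  shows "poly (opuc \<alpha> n) z \<noteq> 0"
proof (induction n)
  case (Suc n)
  show ?case
  proof
    assume "poly (opuc \<alpha> (Suc n)) z = 0"
    hence "z * poly (opuc \<alpha> n) z = cnj (\<alpha> n) * (z ^ n * cnj (poly (opuc \<alpha> n) z))"
      using szego_star_circle[OF assms, of n] by simp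
    hence "cmod (poly (opuc \<alpha> n) z) = cmod (\<alpha> n) * cmod (poly (opuc \<alpha> n) z)"
      using assms by (metis complex_mod_cnj mult_1 norm_mult norm_power power_one)
    with Suc \<alpha>[of n] show False by simp
  qed
qed auto

(* The derivative of arg (z * Phi_n / Phi_n^* ) along the unit circle is positive. *)
lemma opuc_wronskian:
  assumes z: "cmod z = 1"
  defines "u \<equiv> \<lambda>n. pCons 0 (opuc \<alpha> n)" and "v \<equiv> \<lambda>n. szego_star n (opuc \<alpha> n)"
  shows "\<exists>c>0. z * (poly (pderiv (u n)) z * poly (v n) z - poly (u n) z * poly (pderiv (v n)) z)
             = z ^ Suc n * complex_of_real c"
proof (induction n)
  case 0
  show ?case
    by (intro exI[of _ 1]) (simp add: u_def v_def szego_star_def pderiv_pCons)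
next
  case (Suc n)
  then obtain c where c: "c > 0" and
    W: "z * (poly (pderiv (u n)) z * poly (v n) z - poly (u n) z * poly (pderiv (v n)) z)
          = z ^ Suc n * complex_of_real c"
    by blast
  define P where "P = opuc \<alpha> (Suc n)"
  define a where "a = \<alpha> n"
  have P: "P = u n - smult (cnj a) (v n)"
    by (simp add: P_def u_def v_def a_def)
  have u': "u (Suc n) = pCons 0 P"
    by (simp add: u_def P_def)
  have v': "v (Suc n) = v n - smult a (u n)"
    unfolding v_def u_def a_def by (rule szego_star_opuc_Suc)
  have vP: "poly (v (Suc n)) z = z ^ Suc n * cnj (poly P z)"
    unfolding v_def P_def by (rule szego_star_circle[OF z])
  have sq: "poly P z * cnj (poly P z) = complex_of_real ((cmod (poly P z))\<^sup>2)"
    by (metis complex_norm_square)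
  have aa: "a * cnj a = complex_of_real ((cmod a)\<^sup>2)"
    by (metis complex_norm_square)
  have "z * (poly (pderiv (u (Suc n))) z * poly (v (Suc n)) z
               - poly (u (Suc n)) z * poly (pderiv (v (Suc n))) z)
      = z * (poly P z * poly (v (Suc n)) z)
        + z * (z * (poly (pderiv P) z * poly (v (Suc n)) z - poly P z * poly (pderiv (v (Suc n))) z))"
    unfolding u' by (simp add: pderiv_pCons algebra_simps)
  also have "poly (pderiv P) z * poly (v (Suc n)) z - poly P z * poly (pderiv (v (Suc n))) z
      = (1 - a * cnj a) *
        (poly (pderiv (u n)) z * poly (v n) z - poly (u n) z * poly (pderiv (v n)) z)"
    unfolding P v' by (simp add: pderiv_diff pderiv_smult algebra_simps)
  also have "z * (z * ((1 - a * cnj a) *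
        (poly (pderiv (u n)) z * poly (v n) z - poly (u n) z * poly (pderiv (v n)) z)))
      = z * (1 - a * cnj a) * (z ^ Suc n * complex_of_real c)"
    unfolding W [symmetric] by (simp only: mult_ac)
  also have "z * (poly P z * poly (v (Suc n)) z) = z ^ Suc (Suc n) * (poly P z * cnj (poly P z))"
    unfolding vP by simp
  also have "z ^ Suc (Suc n) * (poly P z * cnj (poly P z))
        + z * (1 - a * cnj a) * (z ^ Suc n * complex_of_real c)
      = z ^ Suc (Suc n) * complex_of_real ((cmod (poly P z))\<^sup>2 + (1 - (cmod a)\<^sup>2) * c)"
    unfolding sq aa by (simp add: algebra_simps)
  finally have "z * (poly (pderiv (u (Suc n))) z * poly (v (Suc n)) z
               - poly (u (Suc n)) z * poly (pderiv (v (Suc n))) z) =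
      z ^ Suc (Suc n) * complex_of_real ((cmod (poly P z))\<^sup>2 + (1 - (cmod a)\<^sup>2) * c)" .
  moreover have "(cmod (poly P z))\<^sup>2 + (1 - (cmod a)\<^sup>2) * c > 0"
    using c one_minus_alpha[of n] by (intro add_nonneg_pos mult_pos_pos) (auto simp: a_def)
  ultimately show ?case by blast
qed

lemma popuc_zero_norm:
  assumes \<beta>: "cmod \<beta> = 1" and zero: "poly (popuc \<alpha> \<beta> n) z = 0"
  shows "cmod z = 1"
proof -
  have "z * poly (opuc \<alpha> (n - 1)) z = cnj \<beta> * poly (szego_star (n - 1) (opuc \<alpha> (n - 1))) z"
    using zero by (simp add: popuc_def)
  hence "cmod (z * poly (opuc \<alpha> (n - 1)) z) = cmod (poly (szego_star (n - 1) (opuc \<alpha> (n - 1))) z)"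
    using \<beta> by (simp add: norm_mult)
  thus ?thesis
    using opuc_inside[of z "n - 1"] opuc_outside[of z "n - 1"] by force
qed

lemma rsquarefree_popuc:
  assumes \<beta>: "cmod \<beta> = 1"
  shows "rsquarefree (popuc \<alpha> \<beta> n)"
  unfolding rsquarefree_roots
proof (intro allI notI, elim conjE)
  fix z
  assume z0: "poly (popuc \<alpha> \<beta> n) z = 0" and z1: "poly (pderiv (popuc \<alpha> \<beta> n)) z = 0"
  have z: "cmod z = 1"
    by (rule popuc_zero_norm[OF \<beta> z0])
  let ?u = "pCons 0 (opuc \<alpha> (n - 1))" and ?v = "szego_star (n - 1) (opuc \<alpha> (n - 1))"
  have "poly ?u z = cnj \<beta> * poly ?v z" "poly (pderiv ?u) z = cnj \<beta> * poly (pderiv ?v) z"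
    using z0 z1 by (simp_all add: popuc_def pderiv_diff pderiv_smult)
  hence "poly (pderiv ?u) z * poly ?v z - poly ?u z * poly (pderiv ?v) z = 0"
    by simp
  with opuc_wronskian[OF z, of "n - 1"] z show False
    by auto
qed

lemma degree_popuc:
  assumes "n \<ge> 1"
  shows "degree (popuc \<alpha> \<beta> n) = n"
proof (rule antisym)
  obtain m where n: "n = Suc m" using assms by (cases n) auto
  have "degree (pCons 0 (opuc \<alpha> m)) \<le> Suc m"
    using degree_opuc[of \<alpha> m] degree_pCons_le[of 0 "opuc \<alpha> m"] by linarith
  moreover have "degree (smult (cnj \<beta>) (szego_star m (opuc \<alpha> m))) \<le> Suc m"
    using degree_szego_star[of m "opuc \<alpha> m"]
      degree_smult_le[of "cnj \<beta>" "szego_star m (opuc \<alpha> m)"] by linarith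
  ultimately show "degree (popuc \<alpha> \<beta> n) \<le> n"
    by (simp add: n popuc_def degree_diff_le)
  have "coeff (popuc \<alpha> \<beta> n) n = 1"
    by (simp add: n popuc_def coeff_szego_star coeff_opuc_lead)
  thus "n \<le> degree (popuc \<alpha> \<beta> n)"
    by (intro le_degree) auto
qed

lemma card_zeros_popuc:
  assumes "cmod \<beta> = 1" "n \<ge> 1"
  shows "card {z. poly (popuc \<alpha> \<beta> n) z = 0} = n"
proof -
  let ?p = "popuc \<alpha> \<beta> n"
  have "lead_coeff ?p \<noteq> 0"
    using rsquarefree_popuc[OF assms(1), of n] by (auto simp: rsquarefree_def)
  hence "degree ?p = degree (\<Prod>z | poly ?p z = 0. [:-z, 1:])"
    using complex_poly_decompose_rsquarefree[OF rsquarefree_popuc[OF assms(1), of n]]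
    by (metis degree_smult_eq)
  also have "\<dots> = card {z. poly ?p z = 0}"
    by (subst degree_prod_eq_sum_degree) auto
  finally show ?thesis
    using degree_popuc[OF assms(2), of \<beta>] by simp
qed

lemma ex_ordered_zeros_popuc:
  assumes "cmod \<beta> = 1" "n \<ge> 1"
  shows "\<exists>z. ordered_zeros (popuc \<alpha> \<beta> n) n z"
proof -
  define Z where "Z = {z. poly (popuc \<alpha> \<beta> n) z = 0}"
  define xs where "xs = sorted_list_of_set (Arg2pi ` Z)"
  define g where "g = inv_into Z Arg2pi"
  have card: "card Z = n"
    unfolding Z_def by (rule card_zeros_popuc[OF assms])
  hence fin: "finite Z" using assms(2) by (intro card_ge_0_finite) auto
  have inj: "inj_on Arg2pi Z"
  proof (rule inj_onI)
    fix x y assume "x \<in> Z" "y \<in> Z" "Arg2pi x = Arg2pi y"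
    thus "x = y"
      using popuc_zero_norm[OF assms(1)] complex_norm_eq_1_exp unfolding Z_def
      by (metis mem_Collect_eq)
  qed
  have len: "length xs = n"
    unfolding xs_def using card inj by (simp add: card_image)
  have set: "set xs = Arg2pi ` Z"
    unfolding xs_def using fin by simp
  have sorted: "sorted_wrt (<) xs"
    unfolding xs_def by simp
  have "bij_betw (\<lambda>k. k - 1) {1..n} {..<n}"
    by (rule bij_betwI[where g = Suc]) auto
  moreover have "bij_betw ((!) xs) {..<n} (Arg2pi ` Z)"
    using bij_betw_nth[of xs "{..<n}" "Arg2pi ` Z"] len set sorted
    by (auto simp: strict_sorted_iff)
  moreover have "bij_betw g (Arg2pi ` Z) Z"
    unfolding g_def using inj by (simp add: bij_betw_inv_into inj_on_imp_bij_betw)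
  ultimately have "bij_betw (g \<circ> ((!) xs \<circ> (\<lambda>k. k - 1))) {1..n} Z"
    by (blast intro: bij_betw_trans)
  moreover have "strict_mono_on {1..n} (\<lambda>k. Arg2pi ((g \<circ> ((!) xs \<circ> (\<lambda>k. k - 1))) k))"
  proof (rule strict_mono_onI)
    fix i j assume ij: "i \<in> {1..n}" "j \<in> {1..n}" "i < j"
    have "Arg2pi (g (xs ! (k - 1))) = xs ! (k - 1)" if "k \<in> {1..n}" for k
    proof -
      have "xs ! (k - 1) \<in> Arg2pi ` Z"
        unfolding set [symmetric] using that len by (intro nth_mem) auto
      thus ?thesis unfolding g_def by (rule f_inv_into_f)
    qed
    moreover have "xs ! (i - 1) < xs ! (j - 1)"
      using sorted_wrt_nth_less[OF sorted, of "i - 1" "j - 1"] ij len by auto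
    ultimately show "Arg2pi ((g \<circ> ((!) xs \<circ> (\<lambda>k. k - 1))) i) < Arg2pi ((g \<circ> ((!) xs \<circ> (\<lambda>k. k - 1))) j)"
      using ij by simp
  qed
  ultimately show ?thesis
    unfolding ordered_zeros_def Z_def by blast
qed

end

end

theory Submission
  imports Defs
begin

text \<open>
  Write \<open>\<alpha>\<^sub>n = - a\<^sub>n\<close> with \<open>a\<^sub>n = (n + 2) powr (- b)\<close>.  On the circle \<open>\<Phi>\<^sub>n\<close> and \<open>\<Phi>\<^sub>n\<^sup>*\<close> have
  the same modulus, so \<open>z \<Phi>\<^sub>n = cis (\<eta>\<^sub>n) \<Phi>\<^sub>n\<^sup>*\<close> at \<open>z = cis t\<close> for some phase \<open>\<eta>\<^sub>n\<close>, and the Szego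
  recursion becomes the scalar recursion
  \<open>\<eta>\<^sub>n\<^sub>+\<^sub>1 = t + \<eta>\<^sub>n - 2 \<phi>\<close>, where \<open>\<phi>\<close> is the argument of \<open>1 + a\<^sub>n cis (\<eta>\<^sub>n)\<close> (lemma
  \<open>cis_phase\<close>).  The zeros of the paraorthogonal polynomial of degree \<open>n + 1\<close> are the points
  where \<open>\<eta>\<^sub>n\<close> is an odd multiple of \<open>\<pi>\<close>.  Each step is a Moebius map of the circle, and the
  size of \<open>a\<^sub>n\<close> relative to \<open>sin (t / 2)\<close> decides its nature.

  If \<open>a\<^sub>j \<ge> sin (t / 2)\<close>, the step is hyperbolic or parabolic and maps the arc
  \<open>0 \<le> \<eta> \<le> \<pi> / 2 + t / 2\<close> into itself.  If this holds for all \<open>j\<close> up to \<open>n\<close>, the phase never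
  reaches \<open>\<pi>\<close>.  As \<open>a\<close> decreases, there is no zero with argument in \<open>[0, 2 arcsin a\<^sub>n]\<close>
  (lemmas \<open>phase_trapped\<close> and \<open>ordered_zeros_avoid_one\<close>).

  In any case \<open>\<bar>\<phi>\<bar> \<le> arcsin a\<^sub>j\<close>, so the phase advances by at least \<open>t - 2 arcsin a\<^sub>j\<close> in each
  step.  Let \<open>t = c a\<^sub>n\<close> with \<open>c > 2\<close>.  Since the power law varies slowly, this advance is at
  least a constant times \<open>a\<^sub>n\<close> on a range of indices \<open>j \<in> [l n, n]\<close> with \<open>l < 1\<close>, and in total at
  least a constant times \<open>n powr (1 - b)\<close>, which tends to infinity.  The phase thus passes any
  given number of odd multiples of \<open>\<pi>\<close> before \<open>t = c a\<^sub>n\<close> (lemmas \<open>phase_power_law_at_top\<close>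
  and \<open>ordered_zeros_accumulate\<close>).

  Consequently, for each fixed \<open>k\<close>, the argument of the \<open>k\<close>-th zero is asymptotic to \<open>2 a\<^sub>n\<close>.
  The coefficients are real, so the zeros are symmetric under conjugation and the \<open>k\<close>-th zero
  from the other end behaves likewise (lemma \<open>zeros_near_one\<close>).  The gap around \<open>1\<close> is then
  asymptotic to \<open>4 a\<^sub>n\<close>, and each spacing at fixed distance from it in the order of the zeros is a
  difference of two quantities with the same leading term.
\<close>

section \<open>One step of the phase recursion\<close>

text \<open>
  For \<open>0 \<le> r < 1\<close> this is the principal argument of \<open>1 + r cis x\<close>, whose real part is positive.
  The Moebius map \<open>w \<mapsto> (w + r) / (1 + r w)\<close> takes \<open>cis x\<close> to \<open>cis (x - 2 * deflection r x)\<close>.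
\<close>
definition deflection :: "real \<Rightarrow> real \<Rightarrow> real" where
  "deflection r x = arctan (r * sin x / (1 + r * cos x))"

lemma deflection_bounds: "- (pi / 2) < deflection r x" "deflection r x < pi / 2"
  unfolding deflection_def by (rule arctan_lbound arctan_ubound)+

lemma one_plus_cos_pos:
  fixes r x :: real
  assumes "0 \<le> r" "r < 1"
  shows "0 < 1 + r * cos x"
proof -
  have "r * (- 1) \<le> r * cos x"
    using assms by (intro mult_left_mono) auto
  with assms show ?thesis by simp
qed

text \<open>
  The law of sines in the triangle with vertices \<open>0\<close>, \<open>1\<close> and \<open>1 + r cis x\<close>.
\<close>
lemma sin_deflection:
  assumes "0 \<le> r" "r < 1"
  shows "sin (deflection r x) = r * sin (x - deflection r x)"
proof -
  let ?p = "deflection r x"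
  have "0 < cos ?p"
    by (rule cos_gt_zero_pi) (use deflection_bounds in auto)
  moreover have "tan ?p = r * sin x / (1 + r * cos x)"
    by (simp add: deflection_def tan_arctan)
  ultimately have "sin ?p * (1 + r * cos x) = r * sin x * cos ?p"
    using one_plus_cos_pos[OF assms, of x] by (simp add: tan_def field_simps)
  thus ?thesis by (simp add: sin_diff algebra_simps)
qed

lemma abs_deflection_le:
  assumes "0 \<le> r" "r < 1"
  shows "\<bar>deflection r x\<bar> \<le> arcsin r"
proof -
  have "\<bar>sin (deflection r x)\<bar> \<le> r"
    unfolding sin_deflection[OF assms] using assms mult_left_mono[OF abs_sin_le_one, of r]
    by (simp add: abs_mult)
  hence "sin \<bar>deflection r x\<bar> \<le> r"
    by (auto simp: abs_if split: if_splits)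
  hence "arcsin (sin \<bar>deflection r x\<bar>) \<le> arcsin r"
    using assms by (subst arcsin_le_mono) auto
  thus ?thesis
    using deflection_bounds[of r x] by (subst (asm) arcsin_sin) auto
qed

lemma arcsin_less_half_pi:
  fixes r :: real
  assumes "0 \<le> r" "r < 1"
  shows "arcsin r < pi / 2"
  using assms arcsin_less_mono[of r 1] by simp

lemma cis_deflection:
  assumes "0 \<le> r" "r < 1"
  shows "cis (x - 2 * deflection r x) * (1 + of_real r * cis x) = cis x + of_real r"
proof -
  let ?p = "deflection r x"
  \<comment> \<open>\<open>cis (- ?p)\<close> turns \<open>1 + r cis x\<close> into a real number, equal to its own conjugate.\<close>
  have "Im (cis (- ?p) + of_real r * cis (x - ?p)) = 0"
    using sin_deflection[OF assms, of x] by simp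
  hence conjugate: "cis (- ?p) + of_real r * cis (x - ?p) = cis ?p + of_real r * cis (?p - x)"
    by (auto simp: complex_eq_iff cos_diff algebra_simps sin_diff)
  have "cis (x - 2 * ?p) * (1 + of_real r * cis x)
      = cis (x - ?p) * (cis (- ?p) + of_real r * cis (x - ?p))"
    by (simp add: algebra_simps cis_mult)
  also have "\<dots> = cis x + of_real r"
    unfolding conjugate by (simp add: algebra_simps cis_mult)
  finally show ?thesis .
qed

lemma deflection_zero [simp]: "deflection r 0 = 0"
  by (simp add: deflection_def)

lemma deflection_minus: "deflection r (- x) = - deflection r x"
  by (simp add: deflection_def arctan_minus)

text \<open>
  For \<open>x < \<pi>\<close> the argument of \<open>1 + r cis x\<close> is at most that of \<open>1 + cis x\<close>, which is \<open>x / 2\<close>;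
  for larger \<open>x\<close> the crude bound \<open>\<pi> / 2\<close> on the deflection suffices.
\<close>
lemma deflected_nonneg:
  assumes r: "0 \<le> r" "r < 1" and "0 \<le> x"
  shows "0 \<le> x - 2 * deflection r x"
proof (cases "x < pi")
  case True
  have c: "0 < 1 + cos x"
    using True \<open>0 \<le> x\<close> cos_monotone_0_pi[of x pi] by simp
  have "r * sin x / (1 + r * cos x) \<le> sin x / (1 + cos x)"
  proof -
    have "r * sin x * (1 + cos x) \<le> sin x * (1 + r * cos x)"
      using mult_right_mono[of r 1 "sin x"] r True \<open>0 \<le> x\<close> sin_ge_zero[of x]
      by (simp add: algebra_simps)
    thus ?thesis
      using c one_plus_cos_pos[OF r, of x] by (simp add: divide_simps mult_ac)
  qed
  also have "sin x / (1 + cos x) = tan (x / 2)"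
    using tan_half[of "x / 2"] by (simp add: add.commute)
  finally have "deflection r x \<le> arctan (tan (x / 2))"
    unfolding deflection_def by (rule arctan_monotone')
  thus ?thesis
    using True \<open>0 \<le> x\<close> by (subst (asm) arctan_tan) auto
next
  case False
  thus ?thesis
    using abs_deflection_le[OF r, of x] arcsin_less_half_pi[OF r] by simp
qed

text \<open>
  In the half-angle coordinate \<open>tan (x / 2)\<close> the step multiplies by \<open>(1 - r) / (1 + r)\<close>, so it is
  increasing, and the bound need only hold at the endpoint \<open>x / 2 = q = \<pi> / 4 + t / 4\<close>.  There it
  says \<open>(1 - r) / (1 + r) \<le> cot\<^sup>2 q\<close>, which is the hypothesis \<open>sin (t / 2) \<le> r\<close>.  The proof uses
  sines and cosines instead of tangents, since it must first exclude that the half angle \<open>y\<close> of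
  the image exceeds \<open>\<pi> / 2\<close>.
\<close>
lemma deflected_le:
  assumes r: "0 \<le> r" "r < 1" and t: "0 < t" "t < pi" "sin (t / 2) \<le> r"
    and x: "0 \<le> x" "x \<le> pi / 2 + t / 2"
  shows "x - 2 * deflection r x \<le> pi / 2 - t / 2"
proof (rule ccontr)
  assume gt: "\<not> x - 2 * deflection r x \<le> pi / 2 - t / 2"
  define y where "y = x / 2 - deflection r x"
  define q where "q = pi / 4 + t / 4"
  have y: "pi / 2 - q < y" "y < pi"
    using gt x t deflection_bounds[of r x] unfolding y_def q_def by (auto simp: field_simps)
  have x2: "0 \<le> x / 2" "x / 2 \<le> q"
    using x by (auto simp: q_def)
  have "(1 + r) * (sin y * cos (x / 2)) - (1 - r) * (cos y * sin (x / 2))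
        = sin (y - x / 2) + r * sin (y + x / 2)"
    by (simp add: sin_diff sin_add algebra_simps)
  also have "\<dots> = 0"
    using sin_deflection[OF r, of x] by (simp add: y_def)
  finally have eq: "(1 + r) * (sin y * cos (x / 2)) = (1 - r) * (cos y * sin (x / 2))"
    by simp
  have "0 < sin y"
    using y x2 t by (intro sin_gt_zero) (auto simp: q_def)
  moreover have cosx: "cos q \<le> cos (x / 2)" "0 < cos q"
    using x2 t by (auto simp: q_def intro!: cos_monotone_0_pi_le cos_gt_zero)
  ultimately have "0 < (1 + r) * (sin y * cos (x / 2))"
    using r by simp
  hence "0 < cos y * sin (x / 2)"
    using r by (simp add: eq zero_less_mult_iff)
  moreover have "0 \<le> sin (x / 2)"
    using x2 t by (intro sin_ge_zero) (auto simp: q_def)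
  ultimately have "0 < cos y"
    by (simp add: zero_less_mult_iff)
  have "y < pi / 2"
  proof (rule ccontr)
    assume "\<not> y < pi / 2"
    hence "cos y \<le> cos (pi / 2)"
      using y t by (intro cos_monotone_0_pi_le) auto
    with \<open>0 < cos y\<close> show False by simp
  qed
  have "cos q = sin (pi / 2 - q)" "sin q = cos (pi / 2 - q)"
    by (simp_all add: sin_diff cos_diff)
  moreover have "sin (pi / 2 - q) < sin y" "cos y < cos (pi / 2 - q)"
    using y x2 t \<open>y < pi / 2\<close>
    by (auto simp: q_def intro!: sin_monotone_2pi cos_monotone_0_pi)
  moreover have "sin (x / 2) \<le> sin q"
    using x2 t by (intro sin_monotone_2pi_le) (auto simp: q_def)
  ultimately have less: "cos q * cos q < sin y * cos (x / 2)" "cos y * sin (x / 2) \<le> sin q * sin q"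
    using cosx \<open>0 < sin y\<close> \<open>0 < cos y\<close> \<open>0 \<le> sin (x / 2)\<close>
    by (auto intro!: mult_mono mult_less_le_imp_less)
  have "(1 + r) * (cos q * cos q) < (1 + r) * (sin y * cos (x / 2))"
    using less r by (intro mult_strict_left_mono) auto
  also have "\<dots> \<le> (1 - r) * (sin q * sin q)"
    unfolding eq using less r by (intro mult_left_mono) auto
  finally have "r * ((sin q)\<^sup>2 + (cos q)\<^sup>2) < (sin q)\<^sup>2 - (cos q)\<^sup>2"
    by (simp add: power2_eq_square algebra_simps del: sin_cos_squared_add sin_cos_squared_add2 sin_cos_squared_add3)
  also have "\<dots> = - cos (2 * q)"
    by (simp add: cos_double)
  also have "\<dots> = sin (t / 2)"
    by (simp add: q_def cos_add algebra_simps)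
  finally show False
    using t by simp
qed

section \<open>Counting zeros in order\<close>

text \<open>
  If the \<open>k\<close>-th argument exceeded \<open>t\<close>, only the first \<open>k - 1\<close> zeros could have argument at most
  \<open>t\<close>.
\<close>
lemma ordered_zeros_arg_le:
  assumes z: "ordered_zeros p n z" and k: "k \<in> {1..n}"
    and B: "card B = k" "B \<subseteq> {w. poly p w = 0 \<and> Arg2pi w \<le> t}"
  shows "Arg2pi (z k) \<le> t"
proof (rule ccontr)
  assume gt: "\<not> Arg2pi (z k) \<le> t"
  have "B \<subseteq> z ` {1..<k}"
  proof
    fix w assume w: "w \<in> B"
    then obtain i where i: "i \<in> {1..n}" "w = z i"
      using z B unfolding ordered_zeros_def bij_betw_def by blast
    have "i < k"
    proof (rule ccontr)
      assume "\<not> i < k"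
      hence "Arg2pi (z k) \<le> Arg2pi (z i)"
        using z i k unfolding ordered_zeros_def
        by (cases "i = k") (auto dest: strict_mono_onD[of _ _ k i])
      with gt w i B show False by auto
    qed
    with i show "w \<in> z ` {1..<k}" by auto
  qed
  hence "card B \<le> card {1..<k}"
    using surj_card_le by blast
  with B k show False by auto
qed

lemma ordered_zeros_arg_ge:
  assumes z: "ordered_zeros p n z" and k: "k \<in> {1..n}"
    and B: "card B = k" "B \<subseteq> {w. poly p w = 0 \<and> t \<le> Arg2pi w}"
  shows "t \<le> Arg2pi (z (n - k + 1))"
proof (rule ccontr)
  let ?l = "n - k + 1"
  assume gt: "\<not> t \<le> Arg2pi (z ?l)"
  have "B \<subseteq> z ` {?l<..n}"
  proof
    fix w assume w: "w \<in> B"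
    then obtain i where i: "i \<in> {1..n}" "w = z i"
      using z B unfolding ordered_zeros_def bij_betw_def by blast
    have "?l < i"
    proof (rule ccontr)
      assume "\<not> ?l < i"
      hence "Arg2pi (z i) \<le> Arg2pi (z ?l)"
        using z i k unfolding ordered_zeros_def
        by (cases "i = ?l") (auto dest: strict_mono_onD[of _ _ i ?l])
      with gt w i B show False by auto
    qed
    with i show "w \<in> z ` {?l<..n}" by auto
  qed
  hence "card B \<le> card {?l<..n}"
    using surj_card_le by blast
  with B k show False by auto
qed

section \<open>The phase and the zeros\<close>

text \<open>
  A continuous choice of the argument of \<open>z \<Phi>\<^sub>n(z) / \<Phi>\<^sub>n\<^sup>*(z)\<close> at \<open>z = cis t\<close> for Verblunsky
  coefficients \<open>- a\<^sub>n\<close>.  The values are not reduced modulo \<open>2 \<pi>\<close>, so that the size of the phase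
  counts zeros.
\<close>
primrec phase :: "(nat \<Rightarrow> real) \<Rightarrow> nat \<Rightarrow> real \<Rightarrow> real" where
  "phase a 0 t = t"
| "phase a (Suc n) t = t + (phase a n t - 2 * deflection (a n) (phase a n t))"

lemma phase_minus: "phase a n (- t) = - phase a n t"
  by (induction n) (simp_all add: deflection_minus)

lemma phase_zero [simp]: "phase a n 0 = 0"
  by (induction n) simp_all

context
  fixes a :: "nat \<Rightarrow> real" and \<alpha> :: "nat \<Rightarrow> complex"
  assumes a: "\<And>n. 0 \<le> a n" "\<And>n. a n < 1"
    and \<alpha>_eq: "\<And>n. \<alpha> n = - of_real (a n)"
begin

lemma norm_alpha: "cmod (\<alpha> n) < 1"
  using a[of n] by (simp add: \<alpha>_eq[of n])

lemma continuous_on_phase: "continuous_on S (phase a n)"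
proof (induction n)
  case 0
  show ?case by (simp add: continuous_on_id)
next
  case (Suc n)
  have "1 + a n * cos (phase a n t) \<noteq> 0" for t
    using one_plus_cos_pos[OF a, of n "phase a n t"] by simp
  with Suc show ?case
    by (auto simp: deflection_def intro!: continuous_intros)
qed

lemma cis_phase:
  "cis t * poly (opuc \<alpha> n) (cis t) = cis (phase a n t) * poly (szego_star n (opuc \<alpha> n)) (cis t)"
proof (induction n)
  case 0
  show ?case by (simp add: szego_star_def)
next
  case (Suc n)
  define v where "v = poly (szego_star n (opuc \<alpha> n)) (cis t)"
  define x where "x = phase a n t"
  have "cis t * poly (opuc \<alpha> (Suc n)) (cis t) = cis t * (cis x + of_real (a n)) * v"
    using Suc by (simp add: \<alpha>_eq[of n] v_def x_def algebra_simps)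
  also have "cis x + of_real (a n) = cis (x - 2 * deflection (a n) x) * (1 + of_real (a n) * cis x)"
    using cis_deflection[OF a] by simp
  also have "cis t * (\<dots>) * v = cis (phase a (Suc n) t) * ((1 + of_real (a n) * cis x) * v)"
    by (simp add: x_def cis_mult flip: mult.assoc)
  also have "(1 + of_real (a n) * cis x) * v = poly (szego_star (Suc n) (opuc \<alpha> (Suc n))) (cis t)"
    using Suc unfolding szego_star_opuc_Suc by (simp add: \<alpha>_eq[of n] v_def x_def algebra_simps)
  finally show ?case .
qed

lemma popuc_zero_iff_phase:
  "poly (popuc \<alpha> (-1) (Suc n)) (cis t) = 0 \<longleftrightarrow> cis (phase a n t) = - 1"
proof -
  define v where "v = poly (szego_star n (opuc \<alpha> n)) (cis t)"
  have "v \<noteq> 0"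
    using opuc_circle_nonzero[of \<alpha> "cis t" n] szego_star_circle[of \<alpha> "cis t" n] norm_alpha
    by (simp add: v_def)
  have "poly (popuc \<alpha> (-1) (Suc n)) (cis t) = (cis (phase a n t) + 1) * v"
    using cis_phase[of t n] by (simp add: popuc_def v_def algebra_simps)
  with \<open>v \<noteq> 0\<close> show ?thesis
    by (simp add: add_eq_0_iff2)
qed

lemma popuc_zero_symmetric:
  "poly (popuc \<alpha> (-1) (Suc n)) (cis (- t)) = 0 \<longleftrightarrow> poly (popuc \<alpha> (-1) (Suc n)) (cis t) = 0"
  unfolding popuc_zero_iff_phase phase_minus by (auto simp: complex_eq_iff)

text \<open>
  A step with \<open>a j \<ge> sin (t / 2)\<close> maps \<open>[0, \<pi> / 2 + t / 2]\<close> into \<open>[t, \<pi> / 2 + t / 2]\<close>: the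
  deflection first brings the phase down to at most \<open>\<pi> / 2 - t / 2\<close>, and the rotation adds \<open>t\<close>.
\<close>
lemma phase_trapped:
  assumes t: "0 < t" "t < pi" and le: "\<And>j. j < n \<Longrightarrow> sin (t / 2) \<le> a j"
  shows "0 < phase a n t \<and> phase a n t \<le> pi / 2 + t / 2"
  using le
proof (induction n)
  case 0
  thus ?case using t by simp
next
  case (Suc n)
  hence IH: "0 < phase a n t" "phase a n t \<le> pi / 2 + t / 2" by auto
  hence "0 \<le> phase a n t - 2 * deflection (a n) (phase a n t)"
    "phase a n t - 2 * deflection (a n) (phase a n t) \<le> pi / 2 - t / 2"
    using deflected_nonneg[OF a, of "phase a n t"] deflected_le[OF a t] Suc.prems by auto
  thus ?case using t by simp
qed

lemma phase_nonneg: "0 \<le> t \<Longrightarrow> 0 \<le> phase a n t"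
  by (induction n) (auto intro!: add_nonneg_nonneg simp: deflected_nonneg a simp del: diff_ge_0_iff_ge)

text \<open>
  The steps before \<open>m\<close> contribute only that the phase is nonnegative; each later step adds at
  least \<open>t - s\<close> because the deflection is bounded by \<open>arcsin\<close>.
\<close>
lemma phase_growth:
  assumes t: "0 \<le> t" and le: "\<And>j. j \<ge> m \<Longrightarrow> 2 * arcsin (a j) \<le> s"
  shows "real k * (t - s) \<le> phase a (m + k) t"
proof (induction k)
  case 0
  show ?case using phase_nonneg[OF t] by simp
next
  case (Suc k)
  have "2 * deflection (a (m + k)) (phase a (m + k) t) \<le> s"
    using abs_deflection_le[OF a, of "m + k" "phase a (m + k) t"] le[of "m + k"] by simp
  with Suc show ?case by (simp add: algebra_simps)
qed

lemma no_popuc_zeros_near_one: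
  assumes t: "0 < t" "t < pi" and le: "\<And>j. j < n \<Longrightarrow> sin (t / 2) \<le> a j"
  shows "poly (popuc \<alpha> (-1) (Suc n)) (cis t) \<noteq> 0"
proof
  assume "poly (popuc \<alpha> (-1) (Suc n)) (cis t) = 0"
  hence "cis (phase a n t) = - 1"
    by (simp only: popuc_zero_iff_phase)
  hence "cos (phase a n t) = cos pi"
    by (simp add: complex_eq_iff)
  moreover have "cos pi < cos (phase a n t)"
    using phase_trapped[of t n] t le by (intro cos_monotone_0_pi) auto
  ultimately show False by simp
qed

text \<open>
  The phase is continuous in \<open>t\<close> and vanishes at \<open>t = 0\<close>, so it takes each of the first \<open>k\<close> odd
  multiples of \<open>\<pi>\<close> on the way to \<open>2 k \<pi>\<close>.
\<close>
lemma many_popuc_zeros: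
  assumes t: "0 \<le> t" and growth: "real (2 * k) * pi \<le> phase a n t"
  shows "\<exists>A. card A = k \<and> A \<subseteq> {0<..t} \<and> (\<forall>s\<in>A. poly (popuc \<alpha> (-1) (Suc n)) (cis s) = 0)"
proof -
  have "\<exists>s. 0 \<le> s \<and> s \<le> t \<and> phase a n s = real (2 * i + 1) * pi" if "i < k" for i
  proof (rule IVT')
    have "real (2 * i + 1) * pi \<le> real (2 * k) * pi"
      using that by (intro mult_right_mono) auto
    with growth show "real (2 * i + 1) * pi \<le> phase a n t" by linarith
  qed (use t continuous_on_phase in auto)
  then obtain s where s: "\<And>i. i < k \<Longrightarrow> 0 \<le> s i \<and> s i \<le> t \<and> phase a n (s i) = real (2 * i + 1) * pi"
    by metis
  have "inj_on s {..<k}"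
  proof (rule inj_onI)
    fix i j assume "i \<in> {..<k}" "j \<in> {..<k}" "s i = s j"
    hence "real (2 * i + 1) * pi = real (2 * j + 1) * pi"
      using s by (metis lessThan_iff)
    thus "i = j" by simp
  qed
  moreover have "0 < s i" if "i < k" for i
  proof -
    have "s i \<noteq> 0"
      using s[OF that] phase_zero[of a n] by (auto simp del: phase_zero)
    with s[OF that] show ?thesis by simp
  qed
  moreover have "poly (popuc \<alpha> (-1) (Suc n)) (cis (s i)) = 0" if "i < k" for i
  proof -
    have "cis (real (2 * i + 1) * pi) = - 1"
      by (simp only: complex_eq_iff cis.sel cos_npi sin_npi) simp
    with s[OF that] show ?thesis
      unfolding popuc_zero_iff_phase by simp
  qed
  ultimately show ?thesis
    using s by (intro exI[of _ "s ` {..<k}"]) (auto simp: card_image)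
qed

section \<open>The position of the k-th zero\<close>

lemma popuc_zero_cis:
  assumes "ordered_zeros (popuc \<alpha> (-1) n) n z" "k \<in> {1..n}"
  shows "poly (popuc \<alpha> (-1) n) (cis (Arg2pi (z k))) = 0"
proof -
  have "poly (popuc \<alpha> (-1) n) (z k) = 0"
    using assms by (auto simp: ordered_zeros_def dest: bij_betwE)
  moreover from this have "cmod (z k) = 1"
    using popuc_zero_norm[of \<alpha> "-1" n "z k"] norm_alpha by simp
  hence "z k = cis (Arg2pi (z k))"
    using Arg2pi_eq[of "z k"] by (simp add: cis_conv_exp)
  ultimately show ?thesis by simp
qed

text \<open>
  The point \<open>1\<close> itself is no zero because the phase vanishes there.  A zero with argument at least
  \<open>2 \<pi> - t\<close> would have its conjugate in the arc \<open>(0, t]\<close>.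
\<close>
lemma ordered_zeros_avoid_one:
  assumes z: "ordered_zeros (popuc \<alpha> (-1) (Suc n)) (Suc n) z" and k: "k \<in> {1..Suc n}"
    and t: "t < pi" and le: "\<And>j. j < n \<Longrightarrow> sin (t / 2) \<le> a j"
  shows "t < Arg2pi (z k) \<and> Arg2pi (z k) < 2 * pi - t"
proof -
  have nz: "poly (popuc \<alpha> (-1) (Suc n)) (cis s) \<noteq> 0" if s: "0 \<le> s" "s \<le> t" for s
  proof (cases "s = 0")
    case True
    thus ?thesis using popuc_zero_iff_phase[of n 0] by (simp add: complex_eq_iff)
  next
    case False
    show ?thesis
    proof (rule no_popuc_zeros_near_one)
      have "sin (s / 2) \<le> sin (t / 2)"
        using s t by (intro sin_monotone_2pi_le) auto
      thus "sin (s / 2) \<le> a j" if "j < n" for j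
        using le[OF that] by simp
    qed (use s t False in auto)
  qed
  define x where "x = Arg2pi (z k)"
  have x: "0 \<le> x" "x < 2 * pi"
    by (simp_all add: x_def Arg2pi_ge_0 Arg2pi_lt_2pi)
  have zero: "poly (popuc \<alpha> (-1) (Suc n)) (cis x) = 0"
    unfolding x_def by (rule popuc_zero_cis[OF z k])
  have "cis (- x) = cis (2 * pi - x)"
    by (simp add: complex_eq_iff)
  hence "poly (popuc \<alpha> (-1) (Suc n)) (cis (2 * pi - x)) = 0"
    using zero popuc_zero_symmetric[of n x] by simp
  with zero nz[of x] nz[of "2 * pi - x"] x show ?thesis
    unfolding x_def by fastforce
qed

lemma ordered_zeros_accumulate:
  assumes z: "ordered_zeros (popuc \<alpha> (-1) (Suc n)) (Suc n) z" and k: "k \<in> {1..Suc n}"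
    and t: "0 \<le> t" "t < pi" and growth: "real (2 * k) * pi \<le> phase a n t"
  shows "Arg2pi (z k) \<le> t \<and> 2 * pi - t \<le> Arg2pi (z (Suc n - k + 1))"
proof -
  obtain A where A: "card A = k" "A \<subseteq> {0<..t}"
    and zero: "\<And>s. s \<in> A \<Longrightarrow> poly (popuc \<alpha> (-1) (Suc n)) (cis s) = 0"
    using many_popuc_zeros[OF t(1) growth] by blast
  have arg1: "Arg2pi (cis s) = s" if "s \<in> A" for s
    using that A t by (intro Arg2pi_unique[of 1]) (auto simp: cis_conv_exp)
  have arg2: "Arg2pi (cis (- s)) = 2 * pi - s" if "s \<in> A" for s
  proof -
    \<comment> \<open>\<open>Arg2pi\<close> lies in \<open>[0, 2 \<pi>)\<close>, so \<open>- s\<close> has to be shifted.\<close>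
    have "cis (- s) = cis (2 * pi - s)"
      by (simp add: complex_eq_iff)
    thus ?thesis
      using that A t by (intro Arg2pi_unique[of 1]) (auto simp: cis_conv_exp)
  qed
  have "Arg2pi (z k) \<le> t"
  proof (rule ordered_zeros_arg_le[OF z k])
    show "card (cis ` A) = k"
      using A(1) by (subst card_image) (auto intro: inj_on_inverseI arg1)
  qed (use A zero arg1 in auto)
  moreover have "2 * pi - t \<le> Arg2pi (z (Suc n - k + 1))"
  proof (rule ordered_zeros_arg_ge[OF z k])
    have "inj_on (\<lambda>s. cis (- s)) A"
      by (rule inj_on_inverseI[of _ "\<lambda>w. 2 * pi - Arg2pi w"]) (simp add: arg2)
    thus "card ((\<lambda>s. cis (- s)) ` A) = k"
      using A(1) by (simp add: card_image)
    show "(\<lambda>s. cis (- s)) ` A \<subseteq> {w. poly (popuc \<alpha> (-1) (Suc n)) w = 0 \<and> 2 * pi - t \<le> Arg2pi w}"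
      using A zero arg2 popuc_zero_symmetric by auto
  qed
  ultimately show ?thesis ..
qed

end

section \<open>Growth of the phase for power-law coefficients\<close>

lemma arcsin_le_near_zero:
  fixes q :: real
  assumes "q > 1"
  shows "eventually (\<lambda>x. arcsin x \<le> q * x) (at_right 0)"
proof -
  have "DERIV arcsin 0 :> 1"
    using DERIV_arcsin[of 0] by simp
  hence "((\<lambda>x. arcsin x / x) \<longlongrightarrow> 1) (at 0)"
    by (simp add: DERIV_def)
  hence "((\<lambda>x. arcsin x / x) \<longlongrightarrow> 1) (at_right 0)"
    by (rule tendsto_mono[OF at_le, rotated]) simp
  hence "eventually (\<lambda>x. arcsin x / x < q) (at_right 0)"
    using assms by (rule order_tendstoD)
  thus ?thesis
    using eventually_at_right_less[of 0]
    by eventually_elim (simp add: divide_less_eq)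
qed

lemma le_arcsin:
  fixes x :: real
  assumes "0 \<le> x" "x \<le> 1"
  shows "x \<le> arcsin x"
  using sin_x_le_x[of "arcsin x"] arcsin_le_mono[of 0 x] assms by simp

lemma power_law_tendsto_zero:
  fixes b :: real
  assumes "0 < b"
  shows "(\<lambda>n. (real n + 2) powr (- b)) \<longlonglongrightarrow> 0"
proof (rule tendsto_neg_powr)
  show "LIM n sequentially. real n + 2 :> at_top"
    by (rule filterlim_at_top_mono[OF filterlim_real_sequentially]) simp
qed (use assms in simp)

lemma powr_at_top:
  fixes f :: "'a \<Rightarrow> real"
  assumes "0 < p" and f: "LIM x F. f x :> at_top"
  shows "LIM x F. f x powr p :> at_top"
proof (rule filterlim_at_top_mono)
  show "LIM x F. exp (p * ln (f x)) :> at_top"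
    using assms
    by (intro filterlim_compose[OF exp_at_top] filterlim_tendsto_pos_mult_at_top[OF tendsto_const]
        filterlim_compose[OF ln_at_top])
  have "eventually (\<lambda>x. 0 < f x) F"
    using f by (simp add: filterlim_at_top_dense)
  thus "eventually (\<lambda>x. exp (p * ln (f x)) \<le> f x powr p) F"
    by eventually_elim (simp add: powr_def)
qed

text \<open>
  The scale \<open>c * a (Suc n)\<close> carries the index \<open>Suc n\<close> because \<open>phase a n\<close> governs the
  paraorthogonal polynomial of degree \<open>Suc n\<close>.  The slack \<open>c > 2\<close> is halved: with
  \<open>d = (c + 2) / 2\<close> and \<open>2 q\<^sup>2 = d\<close>, one factor \<open>q > 1\<close> absorbs the quotient \<open>arcsin x / x\<close> for
  small \<open>x\<close>, the other the variation of \<open>a\<close> between the indices \<open>l n\<close> and \<open>n\<close>.  The remaining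
  \<open>c - d\<close> bounds from below what each of the last \<open>(1 - l) n\<close> steps or so gains, in units of
  \<open>a (Suc n)\<close>.
\<close>
lemma phase_power_law_at_top:
  fixes b c :: real
  assumes b: "0 < b" "b < 1" and c: "2 < c"
  defines "a \<equiv> \<lambda>n. (real n + 2) powr (- b)"
  shows "filterlim (\<lambda>n. phase a n (c * a (Suc n))) at_top sequentially"
proof -
  define d where "d = (c + 2) / 2"
  define q where "q = sqrt (d / 2)"
  define l where "l = q powr (- 1 / b)"
  have q: "1 < q" "2 * q * q = d"
    using c by (auto simp: q_def d_def)
  have lq: "l powr (- b) = q"
    using q b by (simp add: l_def powr_powr)
  have l: "0 < l" "l < 1"
    using q b by (auto simp: l_def intro!: powr_less_one)
  have a: "0 \<le> a n" "a n < 1" for n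
    using b powr_less_mono2_neg[of "- b" 1 "real n + 2"] by (auto simp: a_def)
  define m where "m = (\<lambda>n. nat \<lceil>l * (real n + 3)\<rceil>)"
  have "filterlim a (at_right 0) sequentially"
    unfolding filterlim_at
    using power_law_tendsto_zero[OF b(1)] by (simp add: a_def)
  hence "eventually (\<lambda>j. arcsin (a j) \<le> q * a j) sequentially"
    using arcsin_le_near_zero[OF q(1)] by (rule eventually_compose_filterlim[rotated])
  then obtain J where J: "\<And>j. j \<ge> J \<Longrightarrow> arcsin (a j) \<le> q * a j"
    by (auto simp: eventually_sequentially)
  define C where "C = (1 - l) / 2 * (c - d)"
  have "C > 0"
    using l c by (simp add: C_def d_def)
  \<comment> \<open>From \<open>J / l\<close> on, \<open>m n \<ge> J\<close>; from \<open>8 / (1 - l)\<close> on, at least \<open>(1 - l) (n + 3) / 2\<close> steps remain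
      after \<open>m n\<close> in spite of the shifts and of rounding.\<close>
  have "eventually (\<lambda>n. max (J / l) (8 / (1 - l)) \<le> real n) sequentially"
    using filterlim_real_sequentially unfolding filterlim_at_top by blast
  hence "eventually (\<lambda>n. C * (real n + 3) powr (1 - b) \<le> phase a n (c * a (Suc n))) sequentially"
  proof eventually_elim
    case (elim n)
    hence "real J \<le> l * real n" and n: "8 \<le> (1 - l) * real n"
      using l by (auto simp: field_simps)
    moreover have m: "l * (real n + 3) \<le> real (m n)" "real (m n) \<le> l * (real n + 3) + 1"
      using l by (auto simp: m_def)
    ultimately have mn: "J \<le> m n" "(1 - l) / 2 * (real n + 3) \<le> real n - real (m n)"
      using l by (simp_all add: field_simps)
    have "0 \<le> (1 - l) / 2 * (real n + 3)"
      using l by simp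
    with mn have "m n \<le> n" by linarith
    have s: "2 * arcsin (a j) \<le> d * a (Suc n)" if "j \<ge> m n" for j
    proof -
      have "l * (real n + 3) \<le> real j + 2"
        using m that by linarith
      hence "a j \<le> (l * (real n + 3)) powr (- b)"
        unfolding a_def using l b by (intro powr_mono2') auto
      also have "\<dots> = q * a (Suc n)"
        using l by (simp add: powr_mult lq a_def add.commute)
      finally have "2 * q * a j \<le> 2 * q * (q * a (Suc n))"
        using q by (intro mult_left_mono) auto
      also have "\<dots> = d * a (Suc n)"
        unfolding q(2) [symmetric] by simp
      finally show ?thesis
        using J[of j] that mn by simp
    qed
    have "(real n + 3) powr (1 - b) = (real n + 3) * (real n + 3) powr (- b)"
      by (simp add: powr_mult_base)
    hence "C * (real n + 3) powr (1 - b) = (1 - l) / 2 * (real n + 3) * ((c - d) * a (Suc n))"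
      by (simp add: C_def a_def add.commute)
    also have "\<dots> \<le> real (n - m n) * ((c - d) * a (Suc n))"
      using mn \<open>m n \<le> n\<close> c a by (intro mult_right_mono) (auto simp: d_def of_nat_diff)
    also have "\<dots> = real (n - m n) * (c * a (Suc n) - d * a (Suc n))"
      by (simp add: algebra_simps)
    also have "\<dots> \<le> phase a (m n + (n - m n)) (c * a (Suc n))"
    proof (rule phase_growth)
      show "0 \<le> c * a (Suc n)" using a c by simp
    qed (use a s in auto)
    finally show ?case using \<open>m n \<le> n\<close> by simp
  qed
  moreover have "LIM n sequentially. real n + 3 :> at_top"
    by (rule filterlim_at_top_mono[OF filterlim_real_sequentially]) simp
  hence "LIM n sequentially. C * (real n + 3) powr (1 - b) :> at_top"
    using \<open>C > 0\<close> b by (intro filterlim_tendsto_pos_mult_at_top[OF tendsto_const] powr_at_top) auto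
  ultimately show ?thesis
    by (rule filterlim_at_top_mono[rotated])
qed

section \<open>The zeros next to the gap\<close>

text \<open>
  Both ends of the gap at once: the zeros with numbers \<open>k\<close> and \<open>n - k + 1\<close> lie at a
  distance between \<open>2 arcsin \<bar>\<alpha>\<^sub>n\<bar>\<close> and \<open>c \<bar>\<alpha>\<^sub>n\<bar>\<close> from \<open>1\<close>, measured along the circle, on
  opposite sides of it.
\<close>
lemma zeros_near_one:
  fixes b c :: real and \<alpha> :: "nat \<Rightarrow> complex" and \<zeta> :: "nat \<Rightarrow> nat \<Rightarrow> complex"
  assumes b: "0 < b" "b < 1" and c: "2 < c" and k: "1 \<le> k"
    and \<alpha>: "\<And>n. \<alpha> n = complex_of_real (- ((real n + 2) powr (- b)))"
    and \<zeta>: "\<And>n. n \<ge> 1 \<Longrightarrow> ordered_zeros (popuc \<alpha> (-1) n) n (\<zeta> n)"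
  shows "eventually (\<lambda>n. 2 * arcsin (cmod (\<alpha> n)) \<le> Arg2pi (\<zeta> n k) \<and>
                         Arg2pi (\<zeta> n k) \<le> c * cmod (\<alpha> n) \<and>
                         2 * pi - c * cmod (\<alpha> n) \<le> Arg2pi (\<zeta> n (n - k + 1)) \<and>
                         Arg2pi (\<zeta> n (n - k + 1)) \<le> 2 * pi - 2 * arcsin (cmod (\<alpha> n))) sequentially"
proof -
  define a where "a = (\<lambda>n. (real n + 2) powr (- b))"
  have a: "0 \<le> a n" "a n < 1" for n
    using b powr_less_mono2_neg[of "- b" 1 "real n + 2"] by (auto simp: a_def)
  have \<alpha>_a: "\<alpha> n = - of_real (a n)" for n
    by (simp add: \<alpha> a_def)
  hence norm: "cmod (\<alpha> n) = a n" for n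
    using a[of n] by simp
  have mono: "a n \<le> a j" if "j \<le> n" for j n
    unfolding a_def using that b by (intro powr_mono2') auto
  have "eventually (\<lambda>n. real (2 * k) * pi \<le> phase a n (c * a (Suc n))) sequentially"
    using phase_power_law_at_top[OF b c] unfolding a_def filterlim_at_top by blast
  moreover have "a \<longlonglongrightarrow> 0"
    unfolding a_def by (rule power_law_tendsto_zero[OF b(1)])
  hence "(\<lambda>n. c * a (Suc n)) \<longlonglongrightarrow> c * 0"
    by (intro tendsto_mult tendsto_const LIMSEQ_Suc)
  hence "eventually (\<lambda>n. c * a (Suc n) < pi) sequentially"
    by (rule order_tendstoD) simp
  ultimately have "eventually (\<lambda>m. 2 * arcsin (a (Suc m)) \<le> Arg2pi (\<zeta> (Suc m) k) \<and>
                         Arg2pi (\<zeta> (Suc m) k) \<le> c * a (Suc m) \<and>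
                         2 * pi - c * a (Suc m) \<le> Arg2pi (\<zeta> (Suc m) (Suc m - k + 1)) \<and>
                         Arg2pi (\<zeta> (Suc m) (Suc m - k + 1)) \<le> 2 * pi - 2 * arcsin (a (Suc m))) sequentially"
    using eventually_ge_at_top[of k]
  proof eventually_elim
    case (elim m)
    have z: "ordered_zeros (popuc \<alpha> (-1) (Suc m)) (Suc m) (\<zeta> (Suc m))"
      by (rule \<zeta>) simp
    have ks: "k \<in> {1..Suc m}" "Suc m - k + 1 \<in> {1..Suc m}"
      using k elim by auto
    have "2 * arcsin (a (Suc m)) < pi"
      using arcsin_less_half_pi[OF a, of "Suc m"] by simp
    moreover have "sin (2 * arcsin (a (Suc m)) / 2) \<le> a j" if "j < m" for j
      using mono[of j "Suc m"] that a[of "Suc m"] by simp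
    ultimately have avoid: "2 * arcsin (a (Suc m)) < Arg2pi (\<zeta> (Suc m) i) \<and>
        Arg2pi (\<zeta> (Suc m) i) < 2 * pi - 2 * arcsin (a (Suc m))" if "i \<in> {1..Suc m}" for i
      using ordered_zeros_avoid_one[OF a \<alpha>_a z that] by blast
    have "Arg2pi (\<zeta> (Suc m) k) \<le> c * a (Suc m) \<and>
        2 * pi - c * a (Suc m) \<le> Arg2pi (\<zeta> (Suc m) (Suc m - k + 1))"
      using elim c a[of "Suc m"] by (intro ordered_zeros_accumulate[OF a \<alpha>_a z ks(1)]) auto
    with avoid[OF ks(1)] avoid[OF ks(2)] show ?case by simp
  qed
  thus ?thesis
    unfolding norm by (subst (asm) eventually_sequentially_Suc)
qed

lemma tendsto_by_upper_bounds:
  fixes f :: "nat \<Rightarrow> real"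
  assumes "\<And>c. l < c \<Longrightarrow> eventually (\<lambda>n. l \<le> f n \<and> f n \<le> c) sequentially"
  shows "f \<longlonglongrightarrow> l"
proof (rule order_tendstoI)
  fix c assume "c < l"
  thus "eventually (\<lambda>n. c < f n) sequentially"
    using eventually_mono[OF assms[of "l + 1"], of "\<lambda>n. c < f n"] by simp
next
  fix c assume "l < c"
  hence "l < (l + c) / 2" "(l + c) / 2 < c" by auto
  thus "eventually (\<lambda>n. f n < c) sequentially"
    using eventually_mono[OF assms[of "(l + c) / 2"], of "\<lambda>n. f n < c"] by simp
qed

theorem corollary1p2:
  fixes b :: real and \<alpha> :: "nat \<Rightarrow> complex" and \<zeta> :: "nat \<Rightarrow> nat \<Rightarrow> complex"
  assumes b: "0 < b" "b < 1"
    and \<alpha>: "\<And>n. \<alpha> n = complex_of_real (- ((real n + 2) powr (- b)))"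
    and \<zeta>: "\<And>n. n \<ge> 1 \<Longrightarrow> ordered_zeros (popuc \<alpha> (-1) n) n (\<zeta> n)"
  shows "((\<lambda>n. (Arg2pi (\<zeta> n 1) + 2 * pi - Arg2pi (\<zeta> n n)) / (4 * arcsin (cmod (\<alpha> n))))
            \<longlonglongrightarrow> 1) \<and>
         (\<forall>k\<ge>1. ((\<lambda>n. (Arg2pi (\<zeta> n (k + 1)) - Arg2pi (\<zeta> n k)) / cmod (\<alpha> n))
                     \<longlonglongrightarrow> 0) \<and>
                ((\<lambda>n. (Arg2pi (\<zeta> n (n - k + 1)) - Arg2pi (\<zeta> n (n - k))) / cmod (\<alpha> n))
                     \<longlonglongrightarrow> 0))"
proof -
  define r where "r = (\<lambda>n. cmod (\<alpha> n))"
  have r: "0 < r n" "r n < 1" "r n \<le> arcsin (r n)" for n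
  proof -
    show "0 < r n" "r n < 1"
      using b powr_less_mono2_neg[of "- b" 1 "real n + 2"] by (auto simp: r_def \<alpha>)
    thus "r n \<le> arcsin (r n)" by (intro le_arcsin) auto
  qed
  have near: "eventually (\<lambda>n. 2 * arcsin (r n) \<le> Arg2pi (\<zeta> n k) \<and>
                         Arg2pi (\<zeta> n k) \<le> c * r n \<and>
                         2 * pi - c * r n \<le> Arg2pi (\<zeta> n (n - k + 1)) \<and>
                         Arg2pi (\<zeta> n (n - k + 1)) \<le> 2 * pi - 2 * arcsin (r n)) sequentially"
    if "2 < c" "1 \<le> k" for c k
    unfolding r_def by (rule zeros_near_one[OF b that \<alpha> \<zeta>])
  have strict: "Arg2pi (\<zeta> n i) < Arg2pi (\<zeta> n j)" if "i \<in> {1..n}" "j \<in> {1..n}" "i < j" for n i j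
    using \<zeta>[of n] that strict_mono_onD[of "{1..n}" "\<lambda>k. Arg2pi (\<zeta> n k)" i j]
    by (auto simp: ordered_zeros_def)
  have "(\<lambda>n. (Arg2pi (\<zeta> n 1) + 2 * pi - Arg2pi (\<zeta> n n)) / (4 * arcsin (r n))) \<longlonglongrightarrow> 1"
  proof (rule tendsto_by_upper_bounds)
    fix c :: real assume "1 < c"
    hence c: "2 < 2 * c" by simp
    show "eventually (\<lambda>n. 1 \<le> (Arg2pi (\<zeta> n 1) + 2 * pi - Arg2pi (\<zeta> n n)) / (4 * arcsin (r n)) \<and>
        (Arg2pi (\<zeta> n 1) + 2 * pi - Arg2pi (\<zeta> n n)) / (4 * arcsin (r n)) \<le> c) sequentially"
      using near[OF c order_refl] eventually_ge_at_top[of 1]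
    proof eventually_elim
      case (elim n)
      have "c * r n \<le> c * arcsin (r n)"
        using r(3)[of n] \<open>1 < c\<close> by (intro mult_left_mono) auto
      moreover have "0 < arcsin (r n)"
        using r[of n] by linarith
      ultimately show ?case
        using elim by (simp add: field_simps)
    qed
  qed
  moreover have "(\<lambda>n. (Arg2pi (\<zeta> n (k + 1)) - Arg2pi (\<zeta> n k)) / r n) \<longlonglongrightarrow> 0" if k: "1 \<le> k" for k
  proof (rule tendsto_by_upper_bounds)
    fix c :: real assume "0 < c"
    hence c: "2 < c + 2" by simp
    show "eventually (\<lambda>n. 0 \<le> (Arg2pi (\<zeta> n (k + 1)) - Arg2pi (\<zeta> n k)) / r n \<and>
        (Arg2pi (\<zeta> n (k + 1)) - Arg2pi (\<zeta> n k)) / r n \<le> c) sequentially"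
      using near[OF c k] near[OF c le_add2[of 1 k]] eventually_ge_at_top[of "k + 1"]
    proof eventually_elim
      case (elim n)
      thus ?case
        using r[of n] strict[of k n "k + 1"] k by (auto simp: field_simps)
    qed
  qed
  moreover have "(\<lambda>n. (Arg2pi (\<zeta> n (n - k + 1)) - Arg2pi (\<zeta> n (n - k))) / r n) \<longlonglongrightarrow> 0" if k: "1 \<le> k" for k
  proof (rule tendsto_by_upper_bounds)
    fix c :: real assume "0 < c"
    hence c: "2 < c + 2" by simp
    show "eventually (\<lambda>n. 0 \<le> (Arg2pi (\<zeta> n (n - k + 1)) - Arg2pi (\<zeta> n (n - k))) / r n \<and>
        (Arg2pi (\<zeta> n (n - k + 1)) - Arg2pi (\<zeta> n (n - k))) / r n \<le> c) sequentially"
      using near[OF c k] near[OF c le_add2[of 1 k]] eventually_ge_at_top[of "k + 1"]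
    proof eventually_elim
      case (elim n)
      \<comment> \<open>Counted from the end, the zeros \<open>n - k + 1\<close> and \<open>n - k\<close> are the ones numbered \<open>k\<close> and \<open>k + 1\<close>.\<close>
      have "n - (k + 1) + 1 = n - k"
        using elim by simp
      moreover have "Arg2pi (\<zeta> n (n - k)) < Arg2pi (\<zeta> n (n - k + 1))"
        using elim k by (intro strict) auto
      ultimately show ?case
        using elim r[of n] by (auto simp: field_simps)
    qed
  qed
  ultimately show ?thesis
    unfolding r_def by blast
qed

end
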